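(* For every prime $p$, the additive group $(\mathbb{Q}_p,+)$ of the field of $p$-adic numbers is natural.
   Context: A group $(G,* )$ is called natural if there exists a metric $d$ on the underlying set $G$ such that (i) every right translation $R_g: x \mapsto x*g$, $g \in G$, is an isometry of $(G,d)$, and (ii) whenever $(G,\circ)$ is any group structure on the same set $G$ all of whose right translations are isometries of $(G,d)$, then $(G,\circ)$ is isomorphic to $(G,* )$ as an abstract group. The metric $d$ is arbitrary; in particular it need not be the $p$-adic metric nor induce the $p$-adic topology. *)

theory Defs
  imports
    "HOL-Analysis.Abstract_Metric_Spaces"
    "HOL-Algebra.QuotRing"
    "HOL-Computational_Algebra.Primes"
begin

definition padic_val :: "nat \<Rightarrow> rat \<Rightarrow> int" where
  "padic_val p x =
     int (multiplicity (int p) (fst (quotient_of x)))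
       - int (multiplicity (int p) (snd (quotient_of x)))"

definition padic_abs :: "nat \<Rightarrow> rat \<Rightarrow> real" where
  "padic_abs p x = (if x = 0 then 0 else real p powi (- padic_val p x))"

definition padic_cauchy :: "nat \<Rightarrow> (nat \<Rightarrow> rat) \<Rightarrow> bool" where
  "padic_cauchy p X \<longleftrightarrow>
     (\<forall>e>0. \<exists>N. \<forall>m\<ge>N. \<forall>n\<ge>N. padic_abs p (X m - X n) < e)"

definition padic_cauchy_ring :: "nat \<Rightarrow> (nat \<Rightarrow> rat) ring" where
  "padic_cauchy_ring p =
     \<lparr>carrier = {X. padic_cauchy p X},
      monoid.mult = (\<lambda>X Y n. X n * Y n),
      monoid.one = (\<lambda>n. 1),
      ring.zero = (\<lambda>n. 0),
      ring.add = (\<lambda>X Y n. X n + Y n)\<rparr>"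

definition padic_null :: "nat \<Rightarrow> (nat \<Rightarrow> rat) set" where
  "padic_null p =
     {X. padic_cauchy p X \<and> (\<lambda>n. padic_abs p (X n)) \<longlonglongrightarrow> 0}"

text \<open>
  The field of \<open>p\<close>-adic numbers as the completion of the rationals with respect to
  the \<open>p\<close>-adic absolute value: \<open>p\<close>-adic Cauchy sequences modulo null sequences.
\<close>

definition padic_field :: "nat \<Rightarrow> (nat \<Rightarrow> rat) set ring" where
  "padic_field p = padic_cauchy_ring p Quot padic_null p"

definition metric_isometry :: "'a set \<Rightarrow> ('a \<Rightarrow> 'a \<Rightarrow> real) \<Rightarrow> ('a \<Rightarrow> 'a) \<Rightarrow> bool" where
  "metric_isometry M d f \<longleftrightarrow>
     bij_betw f M M \<and> (\<forall>x\<in>M. \<forall>y\<in>M. d (f x) (f y) = d x y)"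

definition right_translations_isometric ::
    "'a monoid \<Rightarrow> ('a \<Rightarrow> 'a \<Rightarrow> real) \<Rightarrow> bool" where
  "right_translations_isometric G d \<longleftrightarrow>
     (\<forall>g\<in>carrier G. metric_isometry (carrier G) d (\<lambda>x. x \<otimes>\<^bsub>G\<^esub> g))"

definition natural_group :: "'a monoid \<Rightarrow> bool" where
  "natural_group G \<longleftrightarrow>
     group G \<and>
     (\<exists>d. Metric_space (carrier G) d \<and>
          right_translations_isometric G d \<and>
          (\<forall>H :: 'a monoid.
             group H \<and> carrier H = carrier G \<and> right_translations_isometric H d
               \<longrightarrow> H \<cong> G))"

end

theory Submission
  imports Defs
begin

text \<open>
  The proof uses only three properties of the additive group \<open>G\<close> of the \<open>p\<close>-adic numbers: it is
  abelian, doubling is a bijection of \<open>G\<close>, and \<open>G\<close> has at most the cardinality of the continuum.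
  Every abelian group with these properties is natural, by the following argument.

  Isometric translations force \<open>d x y\<close> to depend only on \<open>x - y\<close>, and symmetry makes it the same
  for \<open>y - x\<close>; the idea is to let \<open>d x y\<close> determine everything else. Since a function with values in
  \<open>[1, 2]\<close> off the diagonal satisfies the triangle inequality automatically, the distances can be
  chosen freely in that interval. Take an injection \<open>\<iota>\<close> of \<open>G\<close> into \<open>[0, 1)\<close>, which exists by the
  cardinality bound, and put \<open>d x y = 1 + max (\<iota> (x - y)) (\<iota> (y - x))\<close> for \<open>x \<noteq> y\<close>. Then \<open>d x y\<close>
  determines \<open>x - y\<close> up to sign (\<open>metric_from_injection\<close>).

  An isometry \<open>f\<close> of \<open>d\<close> therefore has \<open>f x = \<plusminus> x + f 0\<close> at each point, and comparing two points shows
  that the sign is constant, because \<open>G\<close> has no element of order two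
  (\<open>isometry_translation_or_reflection\<close>). So every isometry is a translation or a reflection
  \<open>x \<mapsto> c - x\<close>. As \<open>c\<close> is divisible by two, a reflection has the fixed point \<open>c / 2\<close>, whereas a right
  translation by a non-neutral element of a group fixes no point. The right translations of a
  competing group \<open>H\<close> on the same set are thus translations of \<open>G\<close>, and \<open>H\<close> is isomorphic to \<open>G\<close>
  (\<open>isomorphic_if_right_translations_translate_or_reflect\<close>).

  For the \<open>p\<close>-adic numbers, as Cauchy sequences of rationals modulo null sequences, bijectivity of
  doubling comes from scaling sequences by \<open>1/2\<close>, which preserves both kinds of sequences even
  for \<open>p = 2\<close>, where it doubles the absolute value. The cardinality bound holds because a sequence of
  rationals is coded by its graph, a subset of a countable set.
\<close>

section \<open>Metrics that determine differences up to inversion\<close>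

text \<open>
  The maximum symmetrises \<open>\<iota>\<close> without losing injectivity: it is the value of \<open>\<iota>\<close> at one of the two
  mutually inverse differences, hence determines that unordered pair. The range of \<open>\<iota>\<close> is bounded
  on the whole type because \<open>Metric_space\<close> demands nonnegativity outside the carrier as well.
\<close>

lemma (in comm_group) metric_from_injection:
  fixes \<iota> :: "'a \<Rightarrow> real"
  assumes inj: "inj_on \<iota> (carrier G)" and range: "range \<iota> \<subseteq> {0..<1}"
    and d_def: "\<And>x y. d x y =
      (if x = y then 0 else 1 + max (\<iota> (x \<otimes> inv y)) (\<iota> (y \<otimes> inv x)))"
  shows "Metric_space (carrier G) d"
    and "\<And>x y g. \<lbrakk>x \<in> carrier G; y \<in> carrier G; g \<in> carrier G\<rbrakk>
           \<Longrightarrow> d (x \<otimes> g) (y \<otimes> g) = d x y"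
    and "\<And>x y u v. \<lbrakk>x \<in> carrier G; y \<in> carrier G; u \<in> carrier G; v \<in> carrier G;
            d x y = d u v\<rbrakk>
           \<Longrightarrow> x \<otimes> inv y = u \<otimes> inv v \<or> x \<otimes> inv y = v \<otimes> inv u"
proof -
  have bounds: "0 \<le> \<iota> x" "\<iota> x < 1" for x
    using range by (auto simp: image_subset_iff)
  have ge1: "1 \<le> d x y" if "x \<noteq> y" for x y
    using that bounds(1)[of "x \<otimes> inv y"] by (simp add: d_def max.coboundedI1)
  have le2: "d x y \<le> 2" for x y
    using bounds(2)[of "x \<otimes> inv y"] bounds(2)[of "y \<otimes> inv x"] by (auto simp: d_def)
  show "Metric_space (carrier G) d"
  proof
    show "0 \<le> d x y" for x y
      using ge1[of x y] by (cases "x = y") (auto simp: d_def)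
    show "d x y = d y x" for x y
      by (auto simp: d_def max.commute)
    show "d x y = 0 \<longleftrightarrow> x = y" if "x \<in> carrier G" "y \<in> carrier G" for x y
      using ge1[of x y] by (auto simp: d_def)
    show "d x z \<le> d x y + d y z"
      if "x \<in> carrier G" "y \<in> carrier G" "z \<in> carrier G" for x y z
    proof (cases "x = y \<or> y = z")
      case True
      then show ?thesis by (auto simp: d_def)
    next
      case False
      then show ?thesis
        using ge1[of x y] ge1[of y z] le2[of x z] by auto
    qed
  qed
  have diff_shift: "(x \<otimes> g) \<otimes> inv (y \<otimes> g) = x \<otimes> inv y"
    if "x \<in> carrier G" "y \<in> carrier G" "g \<in> carrier G" for x y g
  proof -
    have "(x \<otimes> g) \<otimes> inv (y \<otimes> g) = x \<otimes> ((g \<otimes> inv g) \<otimes> inv y)"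
      using that by (simp only: inv_mult_group m_assoc inv_closed m_closed)
    then show ?thesis using that by simp
  qed
  show "d (x \<otimes> g) (y \<otimes> g) = d x y"
    if "x \<in> carrier G" "y \<in> carrier G" "g \<in> carrier G" for x y g
    using that by (auto simp: d_def diff_shift)
  show "x \<otimes> inv y = u \<otimes> inv v \<or> x \<otimes> inv y = v \<otimes> inv u"
    if G: "x \<in> carrier G" "y \<in> carrier G" "u \<in> carrier G" "v \<in> carrier G"
      and eq: "d x y = d u v" for x y u v
  proof (cases "x = y")
    case True
    with eq have "d u v = 0" by (simp add: d_def)
    then have "u = v" using ge1[of u v] by (cases "u = v") auto
    with True G show ?thesis by simp
  next
    case False
    with eq ge1[of x y] have "d u v \<noteq> 0" by auto
    then have "u \<noteq> v" by (auto simp: d_def)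
    with False eq have
      "max (\<iota> (x \<otimes> inv y)) (\<iota> (y \<otimes> inv x)) = max (\<iota> (u \<otimes> inv v)) (\<iota> (v \<otimes> inv u))"
      by (simp add: d_def)
    then have "\<iota> (x \<otimes> inv y) = \<iota> (u \<otimes> inv v) \<or> \<iota> (x \<otimes> inv y) = \<iota> (v \<otimes> inv u)
        \<or> \<iota> (y \<otimes> inv x) = \<iota> (u \<otimes> inv v) \<or> \<iota> (y \<otimes> inv x) = \<iota> (v \<otimes> inv u)"
      by (auto simp: max_def split: if_splits)
    then have "x \<otimes> inv y = u \<otimes> inv v \<or> x \<otimes> inv y = v \<otimes> inv u
        \<or> y \<otimes> inv x = u \<otimes> inv v \<or> y \<otimes> inv x = v \<otimes> inv u"
      using inj G by (auto dest!: inj_onD)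
    moreover have "inv (a \<otimes> inv b) = b \<otimes> inv a"
      if "a \<in> carrier G" "b \<in> carrier G" for a b
      using that by (simp add: inv_mult_group)
    ultimately show ?thesis using G by metis
  qed
qed

text \<open>
  Comparison with the image of \<open>\<one>\<close> gives the claim at every single point. If the sign were
  positive at \<open>x\<close> and negative at \<open>y\<close>, the images would differ by \<open>x \<otimes> y\<close>; for this to be the
  difference of \<open>x\<close> and \<open>y\<close> or its inverse, one of \<open>x\<close>, \<open>y\<close> must be its own inverse, hence
  trivial, and at \<open>\<one>\<close> the two signs agree.
\<close>

lemma (in comm_group) isometry_translation_or_reflection:
  assumes f: "\<And>x. x \<in> carrier G \<Longrightarrow> f x \<in> carrier G"
    and diff: "\<And>x y. \<lbrakk>x \<in> carrier G; y \<in> carrier G\<rbrakk>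
       \<Longrightarrow> f x \<otimes> inv (f y) = x \<otimes> inv y \<or> f x \<otimes> inv (f y) = y \<otimes> inv x"
    and no_involution: "\<And>x. \<lbrakk>x \<in> carrier G; x \<otimes> x = \<one>\<rbrakk> \<Longrightarrow> x = \<one>"
  shows "(\<forall>x\<in>carrier G. f x = x \<otimes> f \<one>) \<or> (\<forall>x\<in>carrier G. f x = inv x \<otimes> f \<one>)"
proof (rule ccontr)
  have c [simp]: "f \<one> \<in> carrier G" using f by simp
  have pointwise: "f x = x \<otimes> f \<one> \<or> f x = inv x \<otimes> f \<one>" if "x \<in> carrier G" for x
    using diff[OF that one_closed] that f[OF that] by (auto simp: inv_solve_right')
  assume "\<not> ?thesis"
  then obtain x y where x: "x \<in> carrier G" "f x \<noteq> inv x \<otimes> f \<one>"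
    and y: "y \<in> carrier G" "f y \<noteq> y \<otimes> f \<one>" by auto
  have fx: "f x = x \<otimes> f \<one>" and fy: "f y = inv y \<otimes> f \<one>"
    using pointwise x y by auto
  have "f x \<otimes> inv (f y) = (x \<otimes> y) \<otimes> (f \<one> \<otimes> inv (f \<one>))"
    unfolding fx fy using x(1) y(1) by (simp add: inv_mult m_ac del: r_inv)
  then have xy: "f x \<otimes> inv (f y) = x \<otimes> y" using x(1) y(1) by simp
  have self_inverse: "z = \<one>" if "z \<in> carrier G" "z = inv z" for z
    using that no_involution[of z] r_inv[of z] by simp
  from diff[OF x(1) y(1)] show False
  proof
    assume "f x \<otimes> inv (f y) = x \<otimes> inv y"
    then have "y = inv y" using xy x(1) y(1) by simp
    then have "y = \<one>" using self_inverse y(1) by blast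
    then show False using y(2) by simp
  next
    assume "f x \<otimes> inv (f y) = y \<otimes> inv x"
    then have "x = inv x" using xy x(1) y(1) by (simp add: m_comm[of x y])
    then have "x = \<one>" using self_inverse x(1) by blast
    then show False using x(2) by simp
  qed
qed

section \<open>Regular groups of isometries\<close>

text \<open>
  Once all right translations \<open>x \<mapsto> x \<otimes>\<^bsub>H\<^esub> g\<close> are known to be translations of \<open>G\<close>, sending \<open>g\<close> to
  the amount of translation \<open>\<one> \<otimes>\<^bsub>H\<^esub> g\<close> is a homomorphism; it is bijective because it is a left
  translation of \<open>H\<close>. The neutral elements of \<open>G\<close> and \<open>H\<close> may differ, so this need not be the
  identity map.
\<close>

lemma (in comm_group) isomorphic_if_right_translations_translate_or_reflect:
  assumes halvable: "\<And>x. x \<in> carrier G \<Longrightarrow> \<exists>y\<in>carrier G. y \<otimes> y = x"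
    and H: "group H" and carrier_H: "carrier H = carrier G"
    and shape: "\<And>g. g \<in> carrier G \<Longrightarrow>
       (\<forall>x\<in>carrier G. x \<otimes>\<^bsub>H\<^esub> g = x \<otimes> (\<one> \<otimes>\<^bsub>H\<^esub> g))
       \<or> (\<forall>x\<in>carrier G. x \<otimes>\<^bsub>H\<^esub> g = inv x \<otimes> (\<one> \<otimes>\<^bsub>H\<^esub> g))"
  shows "H \<cong> G"
proof -
  interpret H: group H by (fact H)
  have closed [simp]: "x \<otimes>\<^bsub>H\<^esub> g \<in> carrier G" if "x \<in> carrier G" "g \<in> carrier G" for x g
    using H.m_closed that by (simp add: carrier_H)
  have translation: "x \<otimes>\<^bsub>H\<^esub> g = x \<otimes> (\<one> \<otimes>\<^bsub>H\<^esub> g)"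
    if x: "x \<in> carrier G" and g: "g \<in> carrier G" for x g
  proof (cases "\<forall>x\<in>carrier G. x \<otimes>\<^bsub>H\<^esub> g = inv x \<otimes> (\<one> \<otimes>\<^bsub>H\<^esub> g)")
    case True
    obtain h where h: "h \<in> carrier G" "h \<otimes> h = \<one> \<otimes>\<^bsub>H\<^esub> g"
      using halvable g by (metis closed one_closed)
    \<comment> \<open>The centre \<open>h\<close> of the reflection is fixed, so \<open>g\<close> is neutral in \<open>H\<close>.\<close>
    have "h \<otimes>\<^bsub>H\<^esub> g = inv h \<otimes> (h \<otimes> h)" unfolding h(2) by (rule bspec[OF True h(1)])
    also have "\<dots> = h" using h(1) by (simp add: m_assoc[symmetric])
    finally have fixed: "h \<otimes>\<^bsub>H\<^esub> g = h" .
    then have "g = \<one>\<^bsub>H\<^esub>" using H.l_cancel_one[of h g] h(1) g carrier_H by simp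
    then show ?thesis using x H.r_one carrier_H by simp
  next
    case False
    then show ?thesis using shape[OF g] x by blast
  qed
  have "(\<lambda>g. \<one> \<otimes>\<^bsub>H\<^esub> g) \<in> iso H G"
  proof (rule isoI)
    show "(\<lambda>g. \<one> \<otimes>\<^bsub>H\<^esub> g) \<in> hom H G"
    proof (rule homI)
      show "\<one> \<otimes>\<^bsub>H\<^esub> x \<in> carrier G" if "x \<in> carrier H" for x
        using that carrier_H by simp
      show "\<one> \<otimes>\<^bsub>H\<^esub> (x \<otimes>\<^bsub>H\<^esub> y) = (\<one> \<otimes>\<^bsub>H\<^esub> x) \<otimes> (\<one> \<otimes>\<^bsub>H\<^esub> y)"
        if "x \<in> carrier H" "y \<in> carrier H" for x y
        using that translation[of "\<one> \<otimes>\<^bsub>H\<^esub> x" y] H.m_assoc[of \<one> x y] carrier_H by simp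
    qed
    show "bij_betw (\<lambda>g. \<one> \<otimes>\<^bsub>H\<^esub> g) (carrier H) (carrier G)"
      unfolding bij_betw_def
      using H.inj_on_cmult[of \<one>] H.surj_const_mult[of \<one>] carrier_H by simp
  qed
  then show ?thesis by (rule is_isoI)
qed

theorem natural_group_of_halvable:
  fixes G :: "'a monoid" (structure)
  assumes comm: "comm_group G"
    and no_involution: "\<And>x. \<lbrakk>x \<in> carrier G; x \<otimes> x = \<one>\<rbrakk> \<Longrightarrow> x = \<one>"
    and halvable: "\<And>x. x \<in> carrier G \<Longrightarrow> \<exists>y\<in>carrier G. y \<otimes> y = x"
    and continuum: "carrier G \<lesssim> {0..<1::real}"
  shows "natural_group G"
proof -
  interpret comm_group G by (rule comm)
  obtain f where f: "inj_on f (carrier G)" "f ` carrier G \<subseteq> {0..<1::real}"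
    using continuum unfolding lepoll_def by blast
  \<comment> \<open>Extended by \<open>0\<close> so that the bounds hold outside the carrier too.\<close>
  define \<iota> where "\<iota> x = (if x \<in> carrier G then f x else 0)" for x
  have inj: "inj_on \<iota> (carrier G)" using f(1) by (simp add: \<iota>_def inj_on_def)
  have range: "range \<iota> \<subseteq> {0..<1}" using f(2) by (auto simp: \<iota>_def)
  define d where "d x y =
    (if x = y then 0 else 1 + max (\<iota> (x \<otimes> inv y)) (\<iota> (y \<otimes> inv x)))" for x y
  note d = metric_from_injection[OF inj range d_def]
  have "(\<lambda>x. x \<otimes> g) ` carrier G = carrier G" if "g \<in> carrier G" for g
    using surj_const_mult[OF that] that by (simp add: m_comm cong: image_cong_simp)
  then have "right_translations_isometric G d"
    unfolding right_translations_isometric_def metric_isometry_def bij_betw_def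
    using d(2) by (simp add: inj_on_multc)
  moreover have "H \<cong> G"
    if H: "group H" "carrier H = carrier G" "right_translations_isometric H d"
    for H :: "'a monoid"
  proof (rule isomorphic_if_right_translations_translate_or_reflect[OF halvable H(1,2)])
    fix g assume g: "g \<in> carrier G"
    have iso: "metric_isometry (carrier G) d (\<lambda>x. x \<otimes>\<^bsub>H\<^esub> g)"
      using H g by (simp add: right_translations_isometric_def)
    have closed: "x \<otimes>\<^bsub>H\<^esub> g \<in> carrier G" if "x \<in> carrier G" for x
      using iso that by (auto simp: metric_isometry_def bij_betw_def)
    show "(\<forall>x\<in>carrier G. x \<otimes>\<^bsub>H\<^esub> g = x \<otimes> (\<one> \<otimes>\<^bsub>H\<^esub> g))
       \<or> (\<forall>x\<in>carrier G. x \<otimes>\<^bsub>H\<^esub> g = inv x \<otimes> (\<one> \<otimes>\<^bsub>H\<^esub> g))"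
    proof (rule isometry_translation_or_reflection)
      show "(x \<otimes>\<^bsub>H\<^esub> g) \<otimes> inv (y \<otimes>\<^bsub>H\<^esub> g) = x \<otimes> inv y
          \<or> (x \<otimes>\<^bsub>H\<^esub> g) \<otimes> inv (y \<otimes>\<^bsub>H\<^esub> g) = y \<otimes> inv x"
        if "x \<in> carrier G" "y \<in> carrier G" for x y
        using d(3)[OF closed closed that] iso that by (simp add: metric_isometry_def)
    qed (rule closed no_involution, assumption+)+
  qed
  ultimately show ?thesis
    unfolding natural_group_def using d(1) is_group by blast
qed

section \<open>The \<open>p\<close>-adic absolute value\<close>

text \<open>
  The valuation may be read off any fraction, not only the reduced one chosen by \<open>quotient_of\<close>.
  This lets sums be computed over a common denominator.
\<close>

lemma padic_val_divide:
  assumes "prime p" "a \<noteq> 0" "b \<noteq> 0"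
  shows "padic_val p (of_int a / of_int b) =
    int (multiplicity (int p) a) - int (multiplicity (int p) b)"
proof -
  obtain n m where nm: "quotient_of (of_int a / of_int b) = (n, m)" by fastforce
  have m: "m > 0" using quotient_of_denom_pos[OF nm] .
  have eq: "(of_int a / of_int b :: rat) = of_int n / of_int m"
    using quotient_of_div[OF nm] .
  with assms m have "(of_int (a * m) :: rat) = of_int (n * b)"
    by (simp add: field_simps)
  then have cross: "a * m = n * b" by linarith
  with assms m have n: "n \<noteq> 0" by auto
  have p: "prime_elem (int p)" using assms(1) by simp
  have "multiplicity (int p) a + multiplicity (int p) m
      = multiplicity (int p) n + multiplicity (int p) b"
    using cross assms m n prime_elem_multiplicity_mult_distrib[OF p] by (metis less_irrefl)
  then show ?thesis by (simp add: padic_val_def nm)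
qed

lemma rat_as_quotient:
  fixes x :: rat
  obtains a b :: int where "b \<noteq> 0" "x = of_int a / of_int b"
  by (metis quotient_of_div quotient_of_denom_pos less_irrefl surj_pair)

lemma padic_abs_nonneg: "0 \<le> padic_abs p x"
  by (simp add: padic_abs_def)

lemma padic_abs_mult:
  assumes "prime p"
  shows "padic_abs p (x * y) = padic_abs p x * padic_abs p y"
proof (cases "x = 0 \<or> y = 0")
  case False
  obtain a b where ab: "b \<noteq> 0" "x = of_int a / of_int b" by (rule rat_as_quotient)
  obtain c e where ce: "e \<noteq> 0" "y = of_int c / of_int e" by (rule rat_as_quotient)
  have nz: "a \<noteq> 0" "c \<noteq> 0" using False ab ce by auto
  have p: "prime_elem (int p)" "real p \<noteq> 0" using assms by (auto simp: prime_gt_0_nat)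
  have xy: "x * y = of_int (a * c) / of_int (b * e)" by (simp add: ab ce)
  have "padic_val p (x * y) = padic_val p x + padic_val p y"
    unfolding xy unfolding ab ce
    using ab ce nz by (subst (1 2 3) padic_val_divide[OF assms])
      (auto simp: prime_elem_multiplicity_mult_distrib[OF p(1)])
  then show ?thesis using False p by (simp add: padic_abs_def flip: power_int_add)
qed (auto simp: padic_abs_def)

lemma padic_abs_minus:
  assumes "prime p" shows "padic_abs p (- x) = padic_abs p x"
proof -
  have "padic_val p (-1) = 0"
    using padic_val_divide[OF assms, of "-1" 1] by (simp add: multiplicity_unit_right)
  then have "padic_abs p (-1) = 1" by (simp add: padic_abs_def)
  then show ?thesis using padic_abs_mult[OF assms, of "-1" x] by simp
qed

text \<open>
  Over a common denominator the ultrametric inequality says that a power of \<open>p\<close> dividing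
  both numerators divides their sum.
\<close>

lemma padic_abs_add_le:
  assumes "prime p"
  shows "padic_abs p (x + y) \<le> max (padic_abs p x) (padic_abs p y)"
proof (cases "x = 0 \<or> y = 0 \<or> x + y = 0")
  case True
  then show ?thesis by (auto simp: padic_abs_def padic_abs_nonneg max_def)
next
  case False
  obtain a b where ab: "b \<noteq> 0" "x = of_int a / of_int b" by (rule rat_as_quotient)
  obtain c e where ce: "e \<noteq> 0" "y = of_int c / of_int e" by (rule rat_as_quotient)
  define s t u where "s = a * e" and "t = c * b" and "u = b * e"
  have u: "u \<noteq> 0" using ab ce by (simp add: u_def)
  have x: "x = of_int s / of_int u" and y: "y = of_int t / of_int u"
    using ab ce by (simp_all add: s_def t_def u_def)
  have xy: "x + y = of_int (s + t) / of_int u" by (simp add: x y add_divide_distrib)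
  have nz: "s \<noteq> 0" "t \<noteq> 0" "s + t \<noteq> 0" using False x y xy by auto
  let ?k = "min (multiplicity (int p) s) (multiplicity (int p) t)"
  have "int p ^ ?k dvd s + t" by (intro dvd_add multiplicity_dvd') auto
  moreover have "\<not> is_unit (int p)" using assms by auto
  ultimately have "?k \<le> multiplicity (int p) (s + t)"
    using nz(3) by (intro multiplicity_geI) auto
  then have "min (padic_val p x) (padic_val p y) \<le> padic_val p (x + y)"
    unfolding xy unfolding x y
    using padic_val_divide[OF assms nz(1) u] padic_val_divide[OF assms nz(2) u]
      padic_val_divide[OF assms nz(3) u] by linarith
  then have "padic_val p x \<le> padic_val p (x + y) \<or> padic_val p y \<le> padic_val p (x + y)"
    by (simp add: min_le_iff_disj)
  moreover have "real p \<ge> 1" using prime_ge_1_nat[OF assms] by simp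
  ultimately have "real p powi (- padic_val p (x + y))
      \<le> max (real p powi (- padic_val p x)) (real p powi (- padic_val p y))"
    unfolding le_max_iff_disj by (metis neg_le_iff_le power_int_increasing)
  then show ?thesis using False by (simp add: padic_abs_def)
qed

section \<open>Cauchy sequences and null sequences\<close>

lemma padic_cauchy_add:
  assumes "prime p" "padic_cauchy p X" "padic_cauchy p Y"
  shows "padic_cauchy p (\<lambda>n. X n + Y n)"
  unfolding padic_cauchy_def
proof (intro allI impI)
  fix e :: real assume "e > 0"
  then obtain M N where
    M: "\<And>m n. \<lbrakk>m \<ge> M; n \<ge> M\<rbrakk> \<Longrightarrow> padic_abs p (X m - X n) < e" and
    N: "\<And>m n. \<lbrakk>m \<ge> N; n \<ge> N\<rbrakk> \<Longrightarrow> padic_abs p (Y m - Y n) < e"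
    using assms(2,3) unfolding padic_cauchy_def by metis
  have "padic_abs p (X m + Y m - (X n + Y n)) < e"
    if "m \<ge> max M N" "n \<ge> max M N" for m n
    using padic_abs_add_le[OF assms(1), of "X m - X n" "Y m - Y n"] M[of m n] N[of m n] that
    by (simp add: algebra_simps)
  then show "\<exists>K. \<forall>m\<ge>K. \<forall>n\<ge>K. padic_abs p (X m + Y m - (X n + Y n)) < e" by blast
qed

lemma padic_cauchy_scale:
  assumes "prime p" "padic_cauchy p X"
  shows "padic_cauchy p (\<lambda>n. c * X n)"
proof (cases "c = 0")
  case True
  then show ?thesis by (auto simp: padic_cauchy_def padic_abs_def)
next
  case False
  then have c: "padic_abs p c > 0"
    using prime_gt_0_nat[OF assms(1)] by (simp add: padic_abs_def)
  show ?thesis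
    unfolding padic_cauchy_def
  proof (intro allI impI)
    fix e :: real assume "e > 0"
    with c have "e / padic_abs p c > 0" by simp
    then obtain N where
      "\<forall>m\<ge>N. \<forall>n\<ge>N. padic_abs p (X m - X n) < e / padic_abs p c"
      using assms(2) unfolding padic_cauchy_def by blast
    then have "\<forall>m\<ge>N. \<forall>n\<ge>N. padic_abs p c * padic_abs p (X m - X n) < e"
      using c by (simp add: pos_less_divide_eq mult.commute)
    moreover have "padic_abs p (c * X m - c * X n) = padic_abs p c * padic_abs p (X m - X n)"
      for m n
      using padic_abs_mult[OF assms(1), of c "X m - X n"] by (simp add: right_diff_distrib)
    ultimately show "\<exists>N. \<forall>m\<ge>N. \<forall>n\<ge>N. padic_abs p (c * X m - c * X n) < e"
      by (intro exI[of _ N]) simp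
  qed
qed

lemma padic_null_add:
  assumes "prime p" "X \<in> padic_null p" "Y \<in> padic_null p"
  shows "(\<lambda>n. X n + Y n) \<in> padic_null p"
proof -
  have lim: "(\<lambda>n. max (padic_abs p (X n)) (padic_abs p (Y n))) \<longlonglongrightarrow> max 0 0"
    using assms by (intro tendsto_max) (auto simp: padic_null_def)
  have "(\<lambda>n. padic_abs p (X n + Y n)) \<longlonglongrightarrow> 0"
  proof (rule tendsto_sandwich)
    show "(\<lambda>n. 0::real) \<longlonglongrightarrow> 0" by simp
    show "(\<lambda>n. max (padic_abs p (X n)) (padic_abs p (Y n))) \<longlonglongrightarrow> 0"
      using lim by simp
  qed (simp_all only: padic_abs_nonneg padic_abs_add_le[OF assms(1)] eventually_True)
  then show ?thesis
    using assms by (auto simp: padic_null_def intro: padic_cauchy_add)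
qed

text \<open>
  Applied with \<open>c = -1\<close> this gives additive inverses, and with \<open>c = 1/2\<close> the absence of elements
  of order two in the quotient.
\<close>

lemma padic_null_scale:
  assumes "prime p" "X \<in> padic_null p"
  shows "(\<lambda>n. c * X n) \<in> padic_null p"
  using assms tendsto_mult_left[of "\<lambda>n. padic_abs p (X n)" 0 sequentially "padic_abs p c"]
  by (auto simp: padic_null_def padic_cauchy_scale padic_abs_mult)

lemma padic_cauchy_zero: "padic_cauchy p (\<lambda>n. 0)"
  by (auto simp: padic_cauchy_def padic_abs_def)

lemma padic_null_zero: "(\<lambda>n. 0) \<in> padic_null p"
  by (auto simp: padic_null_def padic_cauchy_zero padic_abs_def)

section \<open>The additive group of the \<open>p\<close>-adic numbers\<close>

text \<open>
  A constant of its own, so that rewriting with record equations does not expose the components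
  of the ring inside group-theoretic facts.
\<close>

definition padic_cauchy_group :: "nat \<Rightarrow> (nat \<Rightarrow> rat) monoid" where
  "padic_cauchy_group p = add_monoid (padic_cauchy_ring p)"

lemma padic_cauchy_group_simps [simp]:
  "carrier (padic_cauchy_group p) = {X. padic_cauchy p X}"
  "X \<otimes>\<^bsub>padic_cauchy_group p\<^esub> Y = (\<lambda>n. X n + Y n)"
  "\<one>\<^bsub>padic_cauchy_group p\<^esub> = (\<lambda>n. 0)"
  by (simp_all add: padic_cauchy_group_def padic_cauchy_ring_def)

lemma comm_group_padic_cauchy:
  assumes "prime p" shows "comm_group (padic_cauchy_group p)"
proof (rule comm_groupI)
  show "\<exists>Y\<in>carrier (padic_cauchy_group p). Y \<otimes>\<^bsub>padic_cauchy_group p\<^esub> X = \<one>\<^bsub>padic_cauchy_group p\<^esub>"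
    if "X \<in> carrier (padic_cauchy_group p)" for X
    using padic_cauchy_scale[OF assms, of X "-1"] that
    by (intro bexI[of _ "\<lambda>n. - 1 * X n"]) auto
qed (auto simp: padic_cauchy_zero algebra_simps
       intro: padic_cauchy_add[OF assms])

lemma subgroup_padic_null:
  assumes "prime p" shows "subgroup (padic_null p) (padic_cauchy_group p)"
proof -
  interpret comm_group "padic_cauchy_group p" by (rule comm_group_padic_cauchy[OF assms])
  show ?thesis
  proof (rule subgroupI)
    fix X assume X: "X \<in> padic_null p"
    have "inv\<^bsub>padic_cauchy_group p\<^esub> X = (\<lambda>n. -1 * X n)"
      using X padic_cauchy_scale[OF assms, of X "-1"]
      by (intro inv_equality) (auto simp: padic_null_def)
    then show "inv\<^bsub>padic_cauchy_group p\<^esub> X \<in> padic_null p"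
      using padic_null_scale[OF assms X, of "-1"] by simp
  qed (use padic_null_zero padic_null_add[OF assms] in \<open>auto simp: padic_null_def\<close>)
qed

text \<open>
  Only addition matters, so the quotient ring may be replaced by a quotient of abelian groups.
  The two agree because the cosets and the addition of cosets of the ring quotient are
  by definition those of its additive group.
\<close>

lemma add_monoid_padic_field:
  "add_monoid (padic_field p) = padic_cauchy_group p Mod padic_null p"
  by (simp add: padic_cauchy_group_def padic_field_def FactRing_def FactGroup_def A_RCOSETS_def set_add_def fun_eq_iff)

text \<open>
  The quotient is an image of a set of rational sequences, and a sequence is determined by its
  graph, which the countability of \<open>nat \<times> rat\<close> turns into a set of natural numbers.
\<close>

lemma lepoll_reals_padic:
  "carrier (padic_cauchy_group p Mod padic_null p) \<lesssim> {0..<1::real}"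
proof -
  let ?coset = "\<lambda>X. padic_null p #>\<^bsub>padic_cauchy_group p\<^esub> X"
  let ?graph = "\<lambda>X :: nat \<Rightarrow> rat. range (\<lambda>n. to_nat (n, X n))"
  have "carrier (padic_cauchy_group p Mod padic_null p) \<subseteq> range ?coset"
    by (auto simp: FactGroup_def RCOSETS_def)
  then have "carrier (padic_cauchy_group p Mod padic_null p) \<lesssim> range ?coset"
    by (rule subset_imp_lepoll)
  also have "\<dots> \<lesssim> (UNIV :: (nat \<Rightarrow> rat) set)"
    by (rule image_lepoll)
  also have "\<dots> \<lesssim> (UNIV :: nat set set)"
  proof -
    have "inj ?graph"
      by (rule injI) (auto simp: set_eq_iff image_iff fun_eq_iff, metis to_nat_split prod.inject inj_to_nat injD)
    then show ?thesis unfolding lepoll_def by blast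
  qed
  also have "\<dots> \<lesssim> {0..<1::real}" by (rule nat_sets_lepoll_reals01)
  finally show ?thesis .
qed

theorem theorem17:
  fixes p :: nat
  assumes "prime p"
  shows "natural_group (add_monoid (padic_field p))"
proof -
  let ?C = "padic_cauchy_group p" and ?N = "padic_null p"
  let ?Q = "?C Mod ?N"
  interpret C: comm_group ?C by (rule comm_group_padic_cauchy[OF assms])
  have sub: "subgroup ?N ?C" by (rule subgroup_padic_null[OF assms])
  interpret N: normal ?N ?C using C.normal_iff_subgroup sub by blast
  have coset: "\<exists>X. padic_cauchy p X \<and> A = ?N #>\<^bsub>?C\<^esub> X" if "A \<in> carrier ?Q" for A
    using that by (auto simp: FactGroup_def RCOSETS_def)
  have double: "(?N #>\<^bsub>?C\<^esub> X) \<otimes>\<^bsub>?Q\<^esub> (?N #>\<^bsub>?C\<^esub> X) = ?N #>\<^bsub>?C\<^esub> (\<lambda>n. 2 * X n)"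
    if "padic_cauchy p X" for X
    using N.rcos_sum[of X X] that by simp
  have "natural_group ?Q"
  proof (rule natural_group_of_halvable)
    show "comm_group ?Q" by (rule C.abelian_FactGroup[OF sub])
    show "carrier ?Q \<lesssim> {0..<1::real}" by (rule lepoll_reals_padic)
  next
    fix A assume A: "A \<in> carrier ?Q" "A \<otimes>\<^bsub>?Q\<^esub> A = \<one>\<^bsub>?Q\<^esub>"
    from coset[OF A(1)] obtain X where X: "padic_cauchy p X" "A = ?N #>\<^bsub>?C\<^esub> X" by blast
    have "?N #>\<^bsub>?C\<^esub> (\<lambda>n. 2 * X n) = ?N"
      using A(2) double[OF X(1)] X(2) by simp
    then have "(\<lambda>n. 2 * X n) \<in> ?N"
      using C.coset_join1[OF _ _ sub] padic_cauchy_scale[OF assms X(1)] by auto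
    from padic_null_scale[OF assms this, of "1/2"] have "X \<in> ?N" by simp
    then show "A = \<one>\<^bsub>?Q\<^esub>" using X C.coset_join2[OF _ sub] by simp
  next
    fix A assume "A \<in> carrier ?Q"
    from coset[OF this] obtain X where X: "padic_cauchy p X" "A = ?N #>\<^bsub>?C\<^esub> X" by blast
    let ?Y = "\<lambda>n. 1/2 * X n"
    have Y: "padic_cauchy p ?Y" by (rule padic_cauchy_scale[OF assms X(1)])
    then have "?N #>\<^bsub>?C\<^esub> ?Y \<in> carrier ?Q"
      by (auto simp: FactGroup_def RCOSETS_def)
    moreover have "(?N #>\<^bsub>?C\<^esub> ?Y) \<otimes>\<^bsub>?Q\<^esub> (?N #>\<^bsub>?C\<^esub> ?Y) = A"
      using double[OF Y] X(2) by simp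
    ultimately show "\<exists>B\<in>carrier ?Q. B \<otimes>\<^bsub>?Q\<^esub> B = A" by blast
  qed
  then show ?thesis by (simp only: add_monoid_padic_field)
qed

end
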